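(* Let $\phi$ be an analytic self-map of the upper half-plane $\mathbb{H}$ such that $\phi(z)\to\infty$ and $\phi(z)/z\to1$ as $z\to\infty$ non-tangentially. Suppose that $\phi$ is of type Ia and that its forward iterates $z_n=\phi_n(i)$ have arguments tending to $0$. Then $\phi$ cannot have a backward-iteration sequence with bounded steps $\{w_n\}_{n=0}^\infty$ tending to infinity whose argument $\operatorname{Arg} w_n$ also tends to $0$.
   Context: $\mathbb{H}=\{z\in\mathbb{C}:\operatorname{Im} z>0\}$, and $d(z,w)=\left|\frac{w-z}{w-\overline{z}}\right|$ is the pseudo-hyperbolic distance on $\mathbb{H}$. "$z\to\infty$ non-tangentially" means that $z\to\infty$ within a sector $\{|\operatorname{Arg} z-\pi/2|<\theta_0\}$, for each $\theta_0\in(0,\pi/2)$. A backward-iteration sequence with bounded steps for $\phi$ is a sequence $\{w_n\}_{n\ge0}\subset\mathbb{H}$ with $\phi(w_{n+1})=w_n$ and $d(w_n,w_{n+1})\le a<1$ for all $n\ge0$ and some constant $a$. Type Ia: let $z_n=\phi_n(i)$, where $\phi_n$ is the $n$-th iterate of $\phi$. The step-lengths $s_n=d(z_n,z_{n+1})$ decrease to a limit $s_\infty\ge0$ and, by Julia's Lemma, $\operatorname{Im} z_n$ is non-decreasing, with limit $L_\infty\in(0,\infty]$. The map $\phi$ is of type Ia (non-zero-step/finite-height) if $s_\infty>0$ and $L_\infty<\infty$. (This does not depend on the choice of $i$ as starting point.) *)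

theory Defs
  imports "HOL-Analysis.Analysis"
begin

definition upper_half_plane :: "complex set" where
  "upper_half_plane = {z. Im z > 0}"

definition pseudo_hyp_dist :: "complex \<Rightarrow> complex \<Rightarrow> real" where
  "pseudo_hyp_dist z w = cmod ((w - z) / (w - cnj z))"

(* For 0 < \<theta> < pi/2, the only range used, the sector lies in the upper half-plane
   and does not contain 0 (the library sets Arg 0 = 0). *)
definition sector :: "real \<Rightarrow> complex set" where
  "sector \<theta> = {z. \<bar>Arg z - pi / 2\<bar> < \<theta>}"

definition at_infinity_in_sector :: "real \<Rightarrow> complex filter" where
  "at_infinity_in_sector \<theta> = inf at_infinity (principal (sector \<theta>))"

definition analytic_self_map :: "(complex \<Rightarrow> complex) \<Rightarrow> bool" where
  "analytic_self_map \<phi> \<longleftrightarrow>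
     \<phi> holomorphic_on upper_half_plane \<and> \<phi> ` upper_half_plane \<subseteq> upper_half_plane"

definition orbit :: "(complex \<Rightarrow> complex) \<Rightarrow> nat \<Rightarrow> complex" where
  "orbit \<phi> n = (\<phi> ^^ n) \<i>"

(* Non-zero step, finite height. The real limit L expresses that the limit of the heights,
   which a priori lies in (0, \<infinity>], is finite. *)
definition type_Ia :: "(complex \<Rightarrow> complex) \<Rightarrow> bool" where
  "type_Ia \<phi> \<longleftrightarrow>
     (\<exists>s>0. (\<lambda>n. pseudo_hyp_dist (orbit \<phi> n) (orbit \<phi> (Suc n))) \<longlonglongrightarrow> s) \<and>
     (\<exists>L::real. L > 0 \<and> (\<lambda>n. Im (orbit \<phi> n)) \<longlonglongrightarrow> L)"

definition bounded_step_backward_seq ::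
    "(complex \<Rightarrow> complex) \<Rightarrow> (nat \<Rightarrow> complex) \<Rightarrow> bool" where
  "bounded_step_backward_seq \<phi> w \<longleftrightarrow>
     (\<forall>n. w n \<in> upper_half_plane) \<and>
     (\<forall>n. \<phi> (w (Suc n)) = w n) \<and>
     (\<exists>a<1. \<forall>n. pseudo_hyp_dist (w n) (w (Suc n)) \<le> a)"

end

theory Submission
  imports Defs "HOL-Complex_Analysis.Complex_Analysis"
begin

text \<open>
  Write \<open>\<phi>(z) = z + p(z)\<close>. Julia's Lemma gives \<open>Im p \<ge> 0\<close>, so the Schwarz--Pick inequality
  applies to \<open>p\<close> itself. Along the forward orbit \<open>Im p\<close> tends to 0 while \<open>|p|\<close> stays away from
  0, and by Schwarz--Pick consecutive values of \<open>p\<close> are close to each other; so \<open>Re p\<close> is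
  eventually bounded below by a positive constant, because the orbit moves to the right.
  Along a backward sequence \<open>w\<close>, bounded steps give \<open>|p(w)| \<le> C Im w\<close>. Each \<open>w\<close> far to
  the right is at bounded Euclidean distance from some orbit point \<open>z\<close>, and Schwarz--Pick for
  \<open>p\<close> between \<open>w\<close> and \<open>z\<close> bounds \<open>|p(z) - p(w)|\<^sup>2\<close> by a multiple of
  \<open>Im p(z) Im p(w) / Im w\<close>, hence of \<open>Im p(z)\<close>, uniformly even if \<open>Im w\<close> tends to 0. So
  \<open>Re p(w) > 0\<close> far out, and the backward sequence moves to the left: it cannot have
  real parts tending to \<open>+\<infinity>\<close>.
\<close>

section \<open>Schwarz-Pick and Julia's Lemma in the half-plane\<close>

lemma norm_diff_cnj_sq:
  "(cmod (z - cnj w))\<^sup>2 = (cmod (z - w))\<^sup>2 + 4 * Im z * Im w"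
  unfolding cmod_power2 by (simp add: power2_eq_square algebra_simps)

lemma norm_diff_less_norm_diff_cnj:
  assumes "Im z > 0" "Im w > 0"
  shows "cmod (z - w) < cmod (z - cnj w)"
proof -
  have "(cmod (z - w))\<^sup>2 < (cmod (z - cnj w))\<^sup>2"
    using assms by (simp add: norm_diff_cnj_sq)
  then show ?thesis
    by (rule power_less_imp_less_base) simp
qed

text \<open>The Schwarz Lemma, carried over by Cayley maps that send \<open>w\<close> and
  \<open>f w\<close> to 0. Clearing the denominators of the pseudo-hyperbolic distances gives a form
  that passes easily to limits.\<close>

lemma Schwarz_Pick_upper_half_plane_strict:
  assumes hol: "f holomorphic_on upper_half_plane"
    and pos: "\<And>z. Im z > 0 \<Longrightarrow> Im (f z) > 0"
    and z: "Im z > 0" and w: "Im w > 0"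
  shows "(cmod (f z - f w))\<^sup>2 * (Im z * Im w) \<le> (cmod (z - w))\<^sup>2 * (Im (f z) * Im (f w))"
proof -
  \<comment> \<open>\<open>h\<close> inverts the Cayley map taking \<open>z\<close> to
    \<open>(z - w) / (z - cnj w)\<close>, so \<open>g\<close> is \<open>f\<close> read in the unit
    disc.\<close>
  define h where "h = (\<lambda>u::complex. (w - cnj w * u) / (1 - u))"
  define g where "g = (\<lambda>u. (f (h u) - f w) / (f (h u) - cnj (f w)))"
  have h: "Im (h u) > 0" if "u \<in> ball 0 1" for u
  proof -
    have n: "cmod u < 1" using that by simp
    then have u: "1 - u \<noteq> 0" by auto
    have "Im (h u) = Im ((w - cnj w * u) * cnj (1 - u)) / (cmod (1 - u))\<^sup>2"
      unfolding h_def complex_div_cnj[of "w - cnj w * u"]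
      by (simp only: Im_divide_of_real flip: of_real_power)
    also have "Im ((w - cnj w * u) * cnj (1 - u)) = Im w * (1 - (cmod u)\<^sup>2)"
      unfolding cmod_power2 by (simp add: power2_eq_square algebra_simps)
    finally show ?thesis
      using n u w by (simp add: power_less_one_iff abs_square_less_1)
  qed
  have ne: "f (h u) - cnj (f w) \<noteq> 0" if "u \<in> ball 0 1" for u
  proof
    assume "f (h u) - cnj (f w) = 0"
    then have "Im (f (h u) - cnj (f w)) = 0" by simp
    then show False using pos[OF h[OF that]] pos[OF w] by simp
  qed
  have h_hol: "h holomorphic_on ball 0 1"
    unfolding h_def by (intro holomorphic_intros) auto
  have fh: "(\<lambda>u. f (h u)) holomorphic_on ball 0 1"
    using holomorphic_on_compose_gen[OF h_hol hol] h
    by (simp add: o_def upper_half_plane_def image_subset_iff)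
  have g_hol: "g holomorphic_on ball 0 1"
    unfolding g_def by (intro holomorphic_intros fh) (use ne in auto)
  have g0: "g 0 = 0" by (simp add: g_def h_def)
  have g1: "cmod (g u) < 1" if "cmod u < 1" for u
  proof -
    have "u \<in> ball 0 1" using that by simp
    then show ?thesis
      unfolding g_def norm_divide
      using norm_diff_less_norm_diff_cnj[OF pos[OF h] pos[OF w]] ne[of u]
      by (simp add: divide_less_eq)
  qed
  define u where "u = (z - w) / (z - cnj w)"
  have zw: "z - cnj w \<noteq> 0"
    using norm_diff_less_norm_diff_cnj[OF z w] by auto
  have ww: "w - cnj w \<noteq> 0"
    using norm_diff_less_norm_diff_cnj[OF w w] by auto
  have u1: "cmod u < 1"
    unfolding u_def norm_divide using norm_diff_less_norm_diff_cnj[OF z w] zw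
    by (simp add: divide_less_eq)
  have "1 - u = (w - cnj w) / (z - cnj w)"
    unfolding u_def using zw by (simp add: field_simps)
  moreover have "w - cnj w * u = z * (w - cnj w) / (z - cnj w)"
    unfolding u_def using zw by (simp add: field_simps)
  ultimately have hu: "h u = z"
    unfolding h_def using zw ww by simp
  have fzw: "f z - cnj (f w) \<noteq> 0"
    using norm_diff_less_norm_diff_cnj[OF pos[OF z] pos[OF w]] by auto
  have "cmod (g u) \<le> cmod u"
    using Schwarz_Lemma(1)[OF g_hol g0 g1 u1] by simp
  then have "cmod (f z - f w) / cmod (f z - cnj (f w)) \<le> cmod (z - w) / cmod (z - cnj w)"
    by (simp only: g_def hu norm_divide) (simp only: u_def norm_divide)
  then have "cmod (f z - f w) * cmod (z - cnj w) \<le> cmod (z - w) * cmod (f z - cnj (f w))"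
    using zw fzw by (simp add: field_simps)
  then have "(cmod (f z - f w) * cmod (z - cnj w))\<^sup>2
      \<le> (cmod (z - w) * cmod (f z - cnj (f w)))\<^sup>2"
    by (rule power_mono) simp
  \<comment> \<open>Once both squares are expanded, the product of the two squared distances
    cancels, and so does the factor 4.\<close>
  then show ?thesis
    unfolding power_mult_distrib norm_diff_cnj_sq by (simp add: algebra_simps)
qed

text \<open>Add \<i>\<open>e\<close> to \<open>f\<close>, apply the strict version and let
  \<open>e\<close> tend to 0 from the right. The weak sign condition is the one that Julia's Lemma
  provides for a displacement.\<close>

lemma Schwarz_Pick_upper_half_plane:
  assumes hol: "f holomorphic_on upper_half_plane"
    and nonneg: "\<And>z. Im z > 0 \<Longrightarrow> Im (f z) \<ge> 0"
    and z: "Im z > 0" and w: "Im w > 0"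
  shows "(cmod (f z - f w))\<^sup>2 * (Im z * Im w) \<le> (cmod (z - w))\<^sup>2 * (Im (f z) * Im (f w))"
proof (rule tendsto_lowerbound)
  show "((\<lambda>e. (cmod (z - w))\<^sup>2 * ((Im (f z) + e) * (Im (f w) + e)))
      \<longlongrightarrow> (cmod (z - w))\<^sup>2 * (Im (f z) * Im (f w))) (at_right 0)"
    by (auto intro!: tendsto_eq_intros)
  show "\<forall>\<^sub>F e in at_right 0. (cmod (f z - f w))\<^sup>2 * (Im z * Im w)
      \<le> (cmod (z - w))\<^sup>2 * ((Im (f z) + e) * (Im (f w) + e))"
    using eventually_at_right_less
  proof (rule eventually_mono)
    fix e :: real assume e: "0 < e"
    define F where "F = (\<lambda>u. f u + \<i> * of_real e)"
    have "F holomorphic_on upper_half_plane"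
      unfolding F_def by (intro holomorphic_intros hol)
    moreover have "Im (F u) > 0" if "Im u > 0" for u
      using nonneg[OF that] e by (simp add: F_def)
    ultimately show "(cmod (f z - f w))\<^sup>2 * (Im z * Im w)
      \<le> (cmod (z - w))\<^sup>2 * ((Im (f z) + e) * (Im (f w) + e))"
      using Schwarz_Pick_upper_half_plane_strict[of F z w] z w by (simp add: F_def)
  qed
qed simp

text \<open>Schwarz-Pick between \<open>z\<close> and the point at height \<open>t\<close> on the
  imaginary axis, rescaled and taken to the limit as \<open>t\<close> grows.\<close>

lemma Julia_upper_half_plane:
  assumes hol: "f holomorphic_on upper_half_plane"
    and pos: "\<And>z. Im z > 0 \<Longrightarrow> Im (f z) > 0"
    and lim: "((\<lambda>t. f (\<i> * of_real t) / (\<i> * of_real t)) \<longlongrightarrow> 1) at_top"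
    and z: "Im z > 0"
  shows "Im z \<le> Im (f z)"
proof -
  define q where "q = (\<lambda>t::real. f (\<i> * of_real t) / of_real t)"
  have "((\<lambda>t. \<i> * (f (\<i> * of_real t) / (\<i> * of_real t))) \<longlongrightarrow> \<i> * 1) at_top"
    by (intro tendsto_intros lim)
  then have q: "(q \<longlongrightarrow> \<i>) at_top"
    by (simp add: q_def)
  have inv: "((\<lambda>t. complex_of_real (1 / t)) \<longlongrightarrow> 0) at_top"
  proof -
    have "((\<lambda>t::real. 1 / t) \<longlongrightarrow> 0) at_top"
      using tendsto_inverse_0_at_top[OF filterlim_ident] by (simp add: field_simps)
    from tendsto_of_real[OF this, where 'a=complex] show ?thesis by simp
  qed
  have "(cmod (f z * 0 - \<i>))\<^sup>2 * Im z \<le> (cmod (z * 0 - \<i>))\<^sup>2 * (Im (f z) * Im \<i>)"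
  proof (rule tendsto_le)
    show "((\<lambda>t. (cmod (z * complex_of_real (1 / t) - \<i>))\<^sup>2 * (Im (f z) * Im (q t)))
        \<longlongrightarrow> (cmod (z * 0 - \<i>))\<^sup>2 * (Im (f z) * Im \<i>)) at_top"
      by (intro tendsto_intros inv q)
    show "((\<lambda>t. (cmod (f z * complex_of_real (1 / t) - q t))\<^sup>2 * Im z)
        \<longlongrightarrow> (cmod (f z * 0 - \<i>))\<^sup>2 * Im z) at_top"
      by (intro tendsto_intros inv q)
    show "\<forall>\<^sub>F t in at_top. (cmod (f z * complex_of_real (1 / t) - q t))\<^sup>2 * Im z
       \<le> (cmod (z * complex_of_real (1 / t) - \<i>))\<^sup>2 * (Im (f z) * Im (q t))"
      using eventually_gt_at_top[of 0]
    proof (rule eventually_mono)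
      fix t :: real assume t: "0 < t"
      have "f z * complex_of_real (1 / t) - q t = (f z - f (\<i> * of_real t)) / of_real t"
        by (simp add: q_def diff_divide_distrib)
      then have 1: "(cmod (f z * complex_of_real (1 / t) - q t))\<^sup>2
          = (cmod (f z - f (\<i> * of_real t)))\<^sup>2 / t\<^sup>2"
        using t by (simp add: norm_divide power_divide)
      have "z * complex_of_real (1 / t) - \<i> = (z - \<i> * of_real t) / of_real t"
        using t by (simp add: diff_divide_distrib)
      then have 2: "(cmod (z * complex_of_real (1 / t) - \<i>))\<^sup>2
          = (cmod (z - \<i> * of_real t))\<^sup>2 / t\<^sup>2"
        using t by (simp add: norm_divide power_divide)
      have 3: "Im (q t) = Im (f (\<i> * of_real t)) / t"
        by (simp add: q_def)
      have "(cmod (f z - f (\<i> * of_real t)))\<^sup>2 * (Im z * t)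
          \<le> (cmod (z - \<i> * of_real t))\<^sup>2 * (Im (f z) * Im (f (\<i> * of_real t)))"
        using Schwarz_Pick_upper_half_plane_strict[OF hol pos z, of "\<i> * of_real t"] t by simp
      \<comment> \<open>Two of the three powers of \<open>t\<close> rescale the squared distances;
        the third cancels \<open>t\<close> on the left and turns the height of the image into
        \<open>Im (q t)\<close> on the right.\<close>
      then have "(cmod (f z - f (\<i> * of_real t)))\<^sup>2 * (Im z * t) / t ^ 3
          \<le> (cmod (z - \<i> * of_real t))\<^sup>2 * (Im (f z) * Im (f (\<i> * of_real t))) / t ^ 3"
        using t by (intro divide_right_mono) auto
      then show "(cmod (f z * complex_of_real (1 / t) - q t))\<^sup>2 * Im z
       \<le> (cmod (z * complex_of_real (1 / t) - \<i>))\<^sup>2 * (Im (f z) * Im (q t))"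
        unfolding 1 2 3 using t by (simp add: power2_eq_square power3_eq_cube)
    qed
  qed simp
  then show ?thesis by simp
qed

section \<open>Arguments and convergence to infinity\<close>

lemma filterlim_imaginary_axis_sector:
  assumes "0 < \<theta>"
  shows "filterlim (\<lambda>t. \<i> * of_real t) (at_infinity_in_sector \<theta>) at_top"
  unfolding at_infinity_in_sector_def filterlim_inf filterlim_principal
proof
  have "filterlim (\<lambda>t::real. cmod (\<i> * of_real t)) at_top at_top"
    by (simp add: norm_mult filterlim_abs_real)
  then show "filterlim (\<lambda>t. \<i> * complex_of_real t) at_infinity at_top"
    by (rule filterlim_norm_at_top_imp_at_infinity)
  show "\<forall>\<^sub>F t in at_top. \<i> * complex_of_real t \<in> sector \<theta>"
    using eventually_gt_at_top[of 0]
  proof (rule eventually_mono)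
    fix t :: real assume "0 < t"
    then have "Arg (\<i> * of_real t) = pi / 2"
      using Arg_times_of_real2[of t \<i>] by simp
    then show "\<i> * complex_of_real t \<in> sector \<theta>"
      using assms by (simp add: sector_def)
  qed
qed

lemma filterlim_Re_at_top:
  assumes inf: "filterlim w at_infinity sequentially"
    and arg: "(\<lambda>n. Arg (w n)) \<longlonglongrightarrow> 0"
  shows "filterlim (\<lambda>n. Re (w n)) at_top sequentially"
proof -
  have "(\<lambda>n. cos (Arg (w n))) \<longlonglongrightarrow> cos 0"
    by (intro tendsto_intros arg)
  moreover have "filterlim (\<lambda>n. cmod (w n)) at_top sequentially"
    using inf by (rule filterlim_at_infinity_imp_norm_at_top)
  ultimately have "filterlim (\<lambda>n. cos (Arg (w n)) * cmod (w n)) at_top sequentially"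
    by (intro filterlim_tendsto_pos_mult_at_top[where c = 1]) auto
  moreover have "cos (Arg z) * cmod z = Re z" for z
    by (metis Re_rcis mult.commute rcis_cmod_Arg)
  ultimately show ?thesis by simp
qed

text \<open>The modulus is the height divided by the sine of the argument, hence at least
  \<open>c\<close> over a sine tending to 0. This gives divergence of the forward orbit.\<close>

lemma filterlim_at_infinity_of_Arg:
  assumes im: "\<And>n. Im (z n) \<ge> c" and c: "c > 0"
    and arg: "(\<lambda>n. Arg (z n)) \<longlonglongrightarrow> 0"
  shows "filterlim z at_infinity sequentially"
proof -
  have s: "sin (Arg (z n)) > 0" for n
  proof -
    have "cmod (z n) * sin (Arg (z n)) = Im (z n)"
      by (metis Im_rcis rcis_cmod_Arg)
    then show ?thesis
      using im[of n] c by (smt (verit) mult_nonneg_nonpos norm_ge_zero)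
  qed
  have "(\<lambda>n. sin (Arg (z n))) \<longlonglongrightarrow> sin 0"
    by (intro tendsto_intros arg)
  then have "filterlim (\<lambda>n. inverse (sin (Arg (z n)))) at_top sequentially"
    using s by (intro filterlim_inverse_at_top) auto
  then have *: "filterlim (\<lambda>n. c * inverse (sin (Arg (z n)))) at_top sequentially"
    using c by (intro filterlim_tendsto_pos_mult_at_top[where c = c]) auto
  have "filterlim (\<lambda>n. cmod (z n)) at_top sequentially"
  proof (rule filterlim_at_top_mono[OF *], rule always_eventually, rule allI)
    fix n
    have "cmod (z n) * sin (Arg (z n)) = Im (z n)"
      by (metis Im_rcis rcis_cmod_Arg)
    then show "c * inverse (sin (Arg (z n))) \<le> cmod (z n)"
      using im[of n] s[of n] by (simp add: field_simps)
  qed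
  then show ?thesis
    by (rule filterlim_norm_at_top_imp_at_infinity)
qed

section \<open>Hyperbolic steps and Euclidean distances\<close>

lemma pseudo_hyp_dist_sq:
  assumes "Im z > 0" "Im w > 0"
  shows "(pseudo_hyp_dist z w)\<^sup>2 * ((cmod (w - z))\<^sup>2 + 4 * Im z * Im w) = (cmod (w - z))\<^sup>2"
proof -
  have "cmod (w - cnj z) \<noteq> 0"
    using norm_diff_less_norm_diff_cnj[OF assms(2,1)] by auto
  moreover have "(cmod (w - z))\<^sup>2 + 4 * Im z * Im w = (cmod (w - cnj z))\<^sup>2"
    by (simp add: norm_diff_cnj_sq)
  ultimately show ?thesis
    by (simp add: pseudo_hyp_dist_def norm_divide power_divide)
qed

text \<open>The triangle inequality turns a bound by \<open>Im z Im w\<close> into a bound by \<open>Im z\<close> alone.\<close>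

lemma norm_diff_le_of_pseudo_hyp_dist_le:
  assumes z: "Im z > 0" and w: "Im w > 0"
    and a: "pseudo_hyp_dist w z \<le> a" "a < 1"
  shows "cmod (z - w) \<le> 8 / (1 - a\<^sup>2) * Im z"
proof (rule ccontr)
  define P where "P = cmod (z - w)"
  have a0: "0 \<le> a" using a(1) unfolding pseudo_hyp_dist_def by (meson norm_ge_zero order_trans)
  define e where "e = 1 - a\<^sup>2"
  have e: "0 < e" "e \<le> 1"
    using a0 a(2) by (simp_all add: e_def abs_square_less_1)
  \<comment> \<open>The 8 is 4 times 2: the 4 comes from \<open>pseudo_hyp_dist_sq\<close>, and the
    negated bound forces \<open>Im z < P\<close>, so that \<open>Im w < 2 * P\<close>.\<close>
  assume "\<not> cmod (z - w) \<le> 8 / (1 - a\<^sup>2) * Im z"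
  then have big: "8 * Im z < P * e"
    using e by (simp add: P_def e_def[symmetric] field_simps)
  have P0: "0 < P" using big z e by (smt (verit) mult_nonpos_nonneg)
  have "Im w \<le> Im z + P"
    using abs_Im_le_cmod[of "z - w"] by (simp add: P_def)
  have "(pseudo_hyp_dist w z)\<^sup>2 \<le> a\<^sup>2"
    using a(1) by (intro power_mono) (simp_all add: pseudo_hyp_dist_def)
  then have "P\<^sup>2 \<le> a\<^sup>2 * (P\<^sup>2 + 4 * Im w * Im z)"
    using pseudo_hyp_dist_sq[OF w z] z w unfolding P_def[symmetric]
    by (smt (verit) mult_right_mono mult_pos_pos zero_le_power2)
  then have "e * P\<^sup>2 \<le> a\<^sup>2 * (4 * Im w * Im z)"
    by (simp add: e_def algebra_simps)
  also have "\<dots> \<le> 1 * (4 * Im w * Im z)"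
    using e z w by (intro mult_right_mono) (auto simp: e_def)
  also have "\<dots> \<le> 4 * (Im z + P) * Im z"
    using \<open>Im w \<le> Im z + P\<close> z by (simp add: mult_right_mono)
  also have "\<dots> < 4 * (P + P) * Im z"
  proof -
    have "P * e \<le> P" using e P0 by (simp add: mult_left_le)
    then have "Im z < P" using big z by linarith
    then show ?thesis using z by simp
  qed
  also have "\<dots> = P * (8 * Im z)" by simp
  also have "\<dots> < P * (P * e)" using big P0 by (intro mult_strict_left_mono)
  finally show False by (simp add: power2_eq_square algebra_simps)
qed

text \<open>A discrete intermediate value argument: take the first term from \<open>K\<close> on
  that exceeds \<open>u\<close>; its predecessor does not. It serves to find an orbit point nearly
  below or above a given point.\<close>

lemma ex_close_term:
  fixes x :: "nat \<Rightarrow> real"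
  assumes lim: "filterlim x at_top sequentially"
    and step: "\<And>k. \<bar>x (Suc k) - x k\<bar> \<le> B"
    and u: "x K \<le> u"
  obtains k where "k \<ge> K" "\<bar>x k - u\<bar> \<le> B"
proof -
  have "\<exists>j. x (K + j) > u"
    using lim unfolding filterlim_at_top_dense eventually_sequentially
    by (metis le_add2)
  define j where "j = (LEAST j. x (K + j) > u)"
  have j: "x (K + j) > u"
    unfolding j_def using \<open>\<exists>j. x (K + j) > u\<close> by (rule LeastI_ex)
  then have "j \<noteq> 0" using u by (metis add_0_right not_le)
  then obtain i where i: "j = Suc i" by (cases j) auto
  have "\<not> x (K + i) > u"
    using not_less_Least[of i "\<lambda>j. x (K + j) > u"] i unfolding j_def by simp
  then have "\<bar>x (K + j) - u\<bar> \<le> B"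
    using j step[of "K + i"] i by simp
  then show thesis using that[of "K + j"] by simp
qed

section \<open>The displacement of a map that does not lower heights\<close>

locale parabolic_displacement =
  fixes \<phi> p :: "complex \<Rightarrow> complex"
  assumes p_def: "p = (\<lambda>z. \<phi> z - z)"
    and hol: "\<phi> holomorphic_on upper_half_plane"
    and Im_mono: "\<And>z. Im z > 0 \<Longrightarrow> Im z \<le> Im (\<phi> z)"
begin

text \<open>\<open>Im_mono\<close> puts the values of \<open>p\<close> in the closed half-plane. The
  gain over Schwarz-Pick for \<open>\<phi>\<close> is the right-hand side, small wherever heights
  barely grow.\<close>

lemma Schwarz_Pick_displacement:
  assumes "Im z > 0" "Im w > 0"
  shows "(cmod (p z - p w))\<^sup>2 * (Im z * Im w) \<le> (cmod (z - w))\<^sup>2 * (Im (p z) * Im (p w))"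
proof (rule Schwarz_Pick_upper_half_plane[OF _ _ assms])
  show "p holomorphic_on upper_half_plane"
    unfolding p_def by (intro holomorphic_intros hol)
qed (use Im_mono in \<open>auto simp: p_def\<close>)

lemma Im_displacement_nonneg: "Im z > 0 \<Longrightarrow> Im (p z) \<ge> 0"
  using Im_mono[of z] by (simp add: p_def)

lemma orbit_Suc: "orbit \<phi> (Suc n) = orbit \<phi> n + p (orbit \<phi> n)"
  by (simp add: orbit_def p_def)

lemma Im_orbit_ge_1: "Im (orbit \<phi> n) \<ge> 1"
proof (induction n)
  case (Suc n)
  then show ?case
    using Im_mono[of "orbit \<phi> n"] by (simp add: orbit_def)
qed (simp add: orbit_def)

lemma Im_orbit_pos: "Im (orbit \<phi> n) > 0"
  using Im_orbit_ge_1[of n] by linarith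

text \<open>By Schwarz-Pick for \<open>\<phi>\<close>, the squared step divided by the product of
  its two end heights is non-increasing in \<open>n\<close>; its initial value is at most
  \<open>(cmod (p \<i>))^2\<close>. So bounded heights give bounded steps.\<close>

lemma orbit_step_le:
  "(cmod (p (orbit \<phi> n)))\<^sup>2
     \<le> (cmod (p \<i>))\<^sup>2 * (Im (orbit \<phi> n) * Im (orbit \<phi> (Suc n)))"
proof (induction n)
  case 0
  have "1 \<le> Im (orbit \<phi> (Suc 0))" by (rule Im_orbit_ge_1)
  then show ?case
    using mult_left_mono[of 1 "Im (orbit \<phi> (Suc 0))" "(cmod (p \<i>))\<^sup>2"]
    by (simp add: orbit_def)
next
  case (Suc n)
  let ?y = "\<lambda>n. Im (orbit \<phi> n)"
  have pos: "?y n > 0" "?y (Suc n) > 0" "?y (Suc (Suc n)) > 0"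
    by (rule Im_orbit_pos)+
  have "\<phi> (orbit \<phi> k) = orbit \<phi> (Suc k)" for k by (simp add: orbit_def)
  moreover have "(cmod (\<phi> (orbit \<phi> (Suc n)) - \<phi> (orbit \<phi> n)))\<^sup>2 * (?y (Suc n) * ?y n)
      \<le> (cmod (orbit \<phi> (Suc n) - orbit \<phi> n))\<^sup>2
        * (Im (\<phi> (orbit \<phi> (Suc n))) * Im (\<phi> (orbit \<phi> n)))"
  proof (rule Schwarz_Pick_upper_half_plane[OF hol])
    show "0 \<le> Im (\<phi> z)" if "0 < Im z" for z
      using Im_mono[OF that] that by simp
  qed (rule pos)+
  ultimately have "(cmod (p (orbit \<phi> (Suc n))))\<^sup>2 * (?y (Suc n) * ?y n)
      \<le> (cmod (p (orbit \<phi> n)))\<^sup>2 * (?y (Suc (Suc n)) * ?y (Suc n))"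
    using orbit_Suc[of n] orbit_Suc[of "Suc n"] by (metis add_diff_cancel_left')
  also have "\<dots> \<le> (cmod (p \<i>))\<^sup>2 * (?y n * ?y (Suc n)) * (?y (Suc (Suc n)) * ?y (Suc n))"
    using Suc pos by (intro mult_right_mono) auto
  also have "\<dots> = (cmod (p \<i>))\<^sup>2 * (?y (Suc n) * ?y (Suc (Suc n))) * (?y (Suc n) * ?y n)"
    by simp
  finally show ?case
    using pos by (simp add: mult.commute)
qed

text \<open>Eventually \<open>Re p\<close> avoids the interval from \<open>-s / 2\<close> to
  \<open>s / 2\<close> and changes by less than its length \<open>s\<close> at each step, so it
  keeps its sign. A negative sign would contradict \<open>re\<close>.\<close>

lemma eventually_Re_orbit_displacement_ge:
  assumes s: "s > 0" "(\<lambda>n. pseudo_hyp_dist (orbit \<phi> n) (orbit \<phi> (Suc n))) \<longlonglongrightarrow> s"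
    and L: "(\<lambda>n. Im (orbit \<phi> n)) \<longlonglongrightarrow> L"
    and re: "filterlim (\<lambda>n. Re (orbit \<phi> n)) at_top sequentially"
  shows "\<forall>\<^sub>F n in sequentially. Re (p (orbit \<phi> n)) \<ge> s / 2"
proof -
  let ?z = "orbit \<phi>" and ?P = "\<lambda>n. p (orbit \<phi> n)"
  have Im0: "(\<lambda>n. Im (?P n)) \<longlonglongrightarrow> 0"
  proof -
    have "(\<lambda>n. Im (?z (Suc n)) - Im (?z n)) \<longlonglongrightarrow> L - L"
      by (intro tendsto_diff L LIMSEQ_Suc)
    then show ?thesis by (simp add: orbit_Suc)
  qed
  have "\<forall>\<^sub>F n in sequentially. pseudo_hyp_dist (?z n) (?z (Suc n)) > s / 2"
    using s by (intro order_tendstoD(1)[OF s(2)]) simp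
  then have big: "\<forall>\<^sub>F n in sequentially. (cmod (?P n))\<^sup>2 \<ge> s\<^sup>2"
  proof (rule eventually_mono)
    fix n assume d: "pseudo_hyp_dist (?z n) (?z (Suc n)) > s / 2"
    let ?d = "pseudo_hyp_dist (?z n) (?z (Suc n))"
    \<comment> \<open>Heights of at least 1 turn the lower bound on the hyperbolic step into one on
      the Euclidean step.\<close>
    have "1 * 1 \<le> Im (?z n) * Im (?z (Suc n))"
      by (intro mult_mono Im_orbit_ge_1) (use Im_orbit_pos[of n] in auto)
    then have "4 \<le> (cmod (?P n))\<^sup>2 + 4 * Im (?z n) * Im (?z (Suc n))"
      using zero_le_power2[of "cmod (?P n)"] by (simp only: mult.assoc)
    then have "?d\<^sup>2 * 4 \<le> ?d\<^sup>2 * ((cmod (?P n))\<^sup>2 + 4 * Im (?z n) * Im (?z (Suc n)))"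
      by (intro mult_left_mono) auto
    also have "\<dots> = (cmod (?P n))\<^sup>2"
      using pseudo_hyp_dist_sq[OF Im_orbit_pos Im_orbit_pos, of n "Suc n"]
      by (simp only: orbit_Suc add_diff_cancel_left')
    finally have "?d\<^sup>2 * 4 \<le> (cmod (?P n))\<^sup>2" .
    moreover have "(s / 2)\<^sup>2 \<le> ?d\<^sup>2"
      using d s by (intro power_mono) auto
    ultimately show "(cmod (?P n))\<^sup>2 \<ge> s\<^sup>2" by (simp add: power_divide)
  qed
  have "(\<lambda>n. (Im (?P n))\<^sup>2) \<longlonglongrightarrow> 0\<^sup>2"
    by (intro tendsto_intros Im0)
  \<comment> \<open>The complement of 3/4 leaves \<open>(s / 2)^2\<close> for the squared real
    part.\<close>
  then have "\<forall>\<^sub>F n in sequentially. (Im (?P n))\<^sup>2 < 3 / 4 * s\<^sup>2"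
    using s by (intro order_tendstoD(2)[where y = "0\<^sup>2"]) auto
  with big have absRe: "\<forall>\<^sub>F n in sequentially. \<bar>Re (?P n)\<bar> \<ge> s / 2"
  proof eventually_elim
    case (elim n)
    then have "(s / 2)\<^sup>2 \<le> (Re (?P n))\<^sup>2"
      by (simp add: cmod_power2 power_divide)
    then show ?case using s by (metis abs_le_square_iff abs_of_pos half_gt_zero)
  qed
  have "(\<lambda>n. (cmod (p \<i>))\<^sup>2 * (Im (?P n) * Im (?P (Suc n)))) \<longlonglongrightarrow> (cmod (p \<i>))\<^sup>2 * (0 * 0)"
    by (intro tendsto_intros Im0 LIMSEQ_Suc[OF Im0])
  then have "\<forall>\<^sub>F n in sequentially. (cmod (p \<i>))\<^sup>2 * (Im (?P n) * Im (?P (Suc n))) < s\<^sup>2"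
    using s by (intro order_tendstoD(2)) auto
  then have diff: "\<forall>\<^sub>F n in sequentially. \<bar>Re (?P (Suc n)) - Re (?P n)\<bar> < s"
  proof (rule eventually_mono)
    fix n assume n: "(cmod (p \<i>))\<^sup>2 * (Im (?P n) * Im (?P (Suc n))) < s\<^sup>2"
    let ?yy = "Im (?z (Suc n)) * Im (?z n)"
    have yy: "?yy > 0" using Im_orbit_pos by simp
    have "(cmod (?P (Suc n) - ?P n))\<^sup>2 * ?yy \<le> (cmod (?P n))\<^sup>2 * (Im (?P (Suc n)) * Im (?P n))"
      using Schwarz_Pick_displacement[OF Im_orbit_pos Im_orbit_pos, of "Suc n" n]
        orbit_Suc[of n] by (metis add_diff_cancel_left')
    \<comment> \<open>\<open>orbit_step_le\<close> produces the product of heights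
      \<open>?yy\<close> that stands on the left, so it cancels.\<close>
    also have "\<dots> \<le> (cmod (p \<i>))\<^sup>2 * (Im (?z n) * Im (?z (Suc n))) * (Im (?P (Suc n)) * Im (?P n))"
      using orbit_step_le[of n] Im_displacement_nonneg Im_orbit_pos
      by (intro mult_right_mono) auto
    also have "\<dots> = ((cmod (p \<i>))\<^sup>2 * (Im (?P n) * Im (?P (Suc n)))) * ?yy"
      by simp
    also have "\<dots> < s\<^sup>2 * ?yy"
      using n yy by (intro mult_strict_right_mono)
    finally have "(cmod (?P (Suc n) - ?P n))\<^sup>2 < s\<^sup>2"
      by (rule mult_right_less_imp_less) (use yy in simp)
    then have "cmod (?P (Suc n) - ?P n) < s"
      by (rule power2_less_imp_less) (use s in simp)
    then show "\<bar>Re (?P (Suc n)) - Re (?P n)\<bar> < s"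
      using abs_Re_le_cmod[of "?P (Suc n) - ?P n"] by simp
  qed
  from eventually_conj[OF absRe diff] obtain N where
    N: "\<And>n. n \<ge> N \<Longrightarrow> \<bar>Re (?P n)\<bar> \<ge> s / 2"
       "\<And>n. n \<ge> N \<Longrightarrow> \<bar>Re (?P (Suc n)) - Re (?P n)\<bar> < s"
    unfolding eventually_sequentially by blast
  have "Re (?P N) > 0"
  proof (rule ccontr)
    assume neg: "\<not> Re (?P N) > 0"
    have le: "Re (?P n) \<le> 0" if "n \<ge> N" for n
      using that
    proof (induction n rule: dec_induct)
      case (step n)
      show ?case
        using step N(1)[of n] N(1)[of "Suc n"] N(2)[of n] s by linarith
    qed (use neg in simp)
    have "Re (?z n) \<le> Re (?z N)" if "n \<ge> N" for n
      using that
    proof (induction n rule: dec_induct)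
      case (step n)
      then show ?case using le[of n] by (simp add: orbit_Suc)
    qed simp
    moreover obtain M where "\<And>n. n \<ge> M \<Longrightarrow> Re (?z n) > Re (?z N)"
      using re unfolding filterlim_at_top_dense eventually_sequentially by blast
    ultimately show False
      by (metis linorder_not_less nle_le)
  qed
  have "Re (?P n) \<ge> s / 2" if "n \<ge> N" for n
    using that
  proof (induction n rule: dec_induct)
    case (step n)
    show ?case
      using step N(1)[of n] N(1)[of "Suc n"] N(2)[of n] s by linarith
  qed (use N(1)[of N] \<open>Re (?P N) > 0\<close> in simp)
  then show ?thesis
    unfolding eventually_sequentially by blast
qed

text \<open>Far to the right the orbit's rightward drift passes to \<open>p\<close> on
  \<open>w\<close>. As \<open>p (w (Suc n)) = w n - w (Suc n)\<close>, the real parts of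
  \<open>w\<close> then decrease.\<close>

lemma no_backward_sequence_to_right:
  assumes s: "s > 0" "(\<lambda>n. pseudo_hyp_dist (orbit \<phi> n) (orbit \<phi> (Suc n))) \<longlonglongrightarrow> s"
    and L: "(\<lambda>n. Im (orbit \<phi> n)) \<longlonglongrightarrow> L"
    and re: "filterlim (\<lambda>n. Re (orbit \<phi> n)) at_top sequentially"
    and w: "bounded_step_backward_seq \<phi> w"
    and w_re: "filterlim (\<lambda>n. Re (w n)) at_top sequentially"
  shows False
proof -
  let ?z = "orbit \<phi>" and ?P = "\<lambda>n. p (orbit \<phi> n)"
  have w_pos: "Im (w n) > 0" for n
    using w by (simp add: bounded_step_backward_seq_def upper_half_plane_def)
  have w_Suc: "\<phi> (w (Suc n)) = w n" for n
    using w by (simp add: bounded_step_backward_seq_def)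
  obtain a where a: "a < 1" "\<And>n. pseudo_hyp_dist (w n) (w (Suc n)) \<le> a"
    using w by (auto simp: bounded_step_backward_seq_def)
  \<comment> \<open>The constant of \<open>norm_diff_le_of_pseudo_hyp_dist_le\<close>, applied so
    that the bound involves the height of the later term, where \<open>p\<close> is
    evaluated.\<close>
  define C where "C = 8 / (1 - a\<^sup>2)"
  have w_p: "p (w (Suc n)) = w n - w (Suc n)" for n
    by (simp add: p_def w_Suc)
  have pw: "cmod (p (w (Suc n))) \<le> C * Im (w (Suc n))" for n
    using norm_diff_le_of_pseudo_hyp_dist_le[OF w_pos w_pos a(2) a(1), of n]
    by (simp add: w_p C_def norm_minus_commute)
  have w_Im: "Im (w n) \<le> Im (w 0)" for n
  proof (induction n)
    case (Suc n)
    then show ?case using Im_mono[OF w_pos, of "Suc n"] w_Suc[of n] by simp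
  qed simp
  have Im_le: "Im (?z n) \<le> L" for n
  proof (rule incseq_le[OF _ L], rule incseq_SucI)
    show "Im (?z n) \<le> Im (?z (Suc n))" for n
      using Im_displacement_nonneg[OF Im_orbit_pos[of n]] by (simp add: orbit_Suc)
  qed
  have L0: "L > 0" using Im_le[of 0] Im_orbit_pos[of 0] by linarith
  define B where "B = cmod (p \<i>) * L"
  have B: "cmod (?P n) \<le> B" for n
  proof (rule power2_le_imp_le)
    have "(cmod (?P n))\<^sup>2 \<le> (cmod (p \<i>))\<^sup>2 * (Im (?z n) * Im (?z (Suc n)))"
      by (rule orbit_step_le)
    also have "\<dots> \<le> (cmod (p \<i>))\<^sup>2 * (L * L)"
      using Im_le Im_orbit_pos L0 by (intro mult_left_mono mult_mono) (auto intro: less_imp_le)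
    finally show "(cmod (?P n))\<^sup>2 \<le> B\<^sup>2"
      by (simp add: B_def power2_eq_square ac_simps)
  qed (use L0 in \<open>simp add: B_def\<close>)
  \<comment> \<open>Bounds the distance from a point of \<open>w\<close> to a matching orbit point:
    \<open>B\<close> for the real parts, \<open>L\<close> and \<open>Im (w 0)\<close> for the two
    heights.\<close>
  define M where "M = B + L + Im (w 0)"
  have "(\<lambda>n. M\<^sup>2 * C * (Im (?z (Suc n)) - Im (?z n))) \<longlonglongrightarrow> M\<^sup>2 * C * (L - L)"
    by (intro tendsto_intros L LIMSEQ_Suc[OF L])
  then have "\<forall>\<^sub>F n in sequentially. M\<^sup>2 * C * (Im (?z (Suc n)) - Im (?z n)) < (s / 2)\<^sup>2"
    using s by (intro order_tendstoD(2)) auto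
  then have "\<forall>\<^sub>F n in sequentially. M\<^sup>2 * C * Im (?P n) < (s / 2)\<^sup>2"
    by (simp add: orbit_Suc)
  from eventually_conj[OF this eventually_Re_orbit_displacement_ge[OF s L re]]
  \<comment> \<open>From \<open>K\<close> on, \<open>p\<close> at the orbit point has real part at
    least \<open>s / 2\<close>, and the estimate below will put \<open>p\<close> at the backward
    point within less than \<open>s / 2\<close> of it.\<close>
  obtain K where K: "\<And>k. k \<ge> K \<Longrightarrow> M\<^sup>2 * C * Im (?P k) < (s / 2)\<^sup>2"
      "\<And>k. k \<ge> K \<Longrightarrow> Re (?P k) \<ge> s / 2"
    unfolding eventually_sequentially by blast

  have step: "\<bar>Re (?z (Suc k)) - Re (?z k)\<bar> \<le> B" for k
    using order_trans[OF abs_Re_le_cmod B[of k]] by (simp add: orbit_Suc)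
  have Re_pos: "Re (p (w (Suc n))) > 0" if n: "Re (?z K) \<le> Re (w (Suc n))" for n
  proof -
    let ?w = "w (Suc n)"
    obtain k where k: "k \<ge> K" "\<bar>Re (?z k) - Re ?w\<bar> \<le> B"
      using ex_close_term[OF re step n] by blast
    have "cmod (?z k - ?w) \<le> \<bar>Re (?z k - ?w)\<bar> + \<bar>Im (?z k - ?w)\<bar>"
      by (rule cmod_le)
    also have "\<dots> \<le> M"
      using k(2) Im_le[of k] w_Im[of "Suc n"] Im_orbit_pos[of k] w_pos[of "Suc n"]
      by (simp add: M_def)
    finally have dist: "cmod (?z k - ?w) \<le> M" .
    have Imp: "0 \<le> Im (?P k)" "0 \<le> Im (p ?w)"
      by (intro Im_displacement_nonneg Im_orbit_pos w_pos)+
    have "(cmod (?P k - p ?w))\<^sup>2 * Im ?w \<le> (cmod (?P k - p ?w))\<^sup>2 * (Im (?z k) * Im ?w)"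
      using Im_orbit_ge_1[of k] w_pos[of "Suc n"] by (intro mult_left_mono) auto
    also have "\<dots> \<le> (cmod (?z k - ?w))\<^sup>2 * (Im (?P k) * Im (p ?w))"
      by (intro Schwarz_Pick_displacement Im_orbit_pos w_pos)
    also have "\<dots> \<le> M\<^sup>2 * (Im (?P k) * (C * Im ?w))"
    proof (intro mult_mono power_mono dist)
      show "Im (p ?w) \<le> C * Im ?w"
        using pw[of n] abs_Im_le_cmod[of "p ?w"] by linarith
    qed (use Imp in auto)
    also have "\<dots> = (M\<^sup>2 * C * Im (?P k)) * Im ?w" by simp
    also have "\<dots> < (s / 2)\<^sup>2 * Im ?w"
      using K(1)[OF k(1)] w_pos[of "Suc n"] by (intro mult_strict_right_mono)
    finally have "(cmod (?P k - p ?w))\<^sup>2 < (s / 2)\<^sup>2"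
      by (rule mult_right_less_imp_less) (use w_pos[of "Suc n"] in simp)
    then have "cmod (?P k - p ?w) < s / 2"
      by (rule power2_less_imp_less) (use s in simp)
    then show ?thesis
      using abs_Re_le_cmod[of "?P k - p ?w"] K(2)[OF k(1)] by simp
  qed
  obtain N where N: "\<And>n. n \<ge> N \<Longrightarrow> Re (?z K) \<le> Re (w n)"
    using w_re unfolding filterlim_at_top eventually_sequentially by blast
  have "Re (w n) \<le> Re (w N)" if "n \<ge> N" for n
    using that
  proof (induction n rule: dec_induct)
    case (step n)
    then show ?case
      using Re_pos[of n] N[of "Suc n"] by (simp add: w_p)
  qed simp
  moreover obtain m where "\<And>n. n \<ge> m \<Longrightarrow> Re (w n) > Re (w N)"
    using w_re unfolding filterlim_at_top_dense eventually_sequentially by blast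
  ultimately show False
    by (metis linorder_not_less nle_le)
qed

end

theorem corollary1p22:
  fixes \<phi> :: "complex \<Rightarrow> complex"
  assumes "analytic_self_map \<phi>"
    and "\<And>\<theta>. 0 < \<theta> \<Longrightarrow> \<theta> < pi / 2 \<Longrightarrow> filterlim \<phi> at_infinity (at_infinity_in_sector \<theta>)"
    and "\<And>\<theta>. 0 < \<theta> \<Longrightarrow> \<theta> < pi / 2 \<Longrightarrow> ((\<lambda>z. \<phi> z / z) \<longlongrightarrow> 1) (at_infinity_in_sector \<theta>)"
    and "type_Ia \<phi>"
    and "(\<lambda>n. Arg (orbit \<phi> n)) \<longlonglongrightarrow> 0"
  shows "\<not> (\<exists>w :: nat \<Rightarrow> complex.
            bounded_step_backward_seq \<phi> w \<and>
            filterlim w at_infinity sequentially \<and>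
            (\<lambda>n. Arg (w n)) \<longlonglongrightarrow> 0)"
proof
  have hol: "\<phi> holomorphic_on upper_half_plane"
    and pos: "\<And>z. Im z > 0 \<Longrightarrow> Im (\<phi> z) > 0"
    using assms(1) by (auto simp: analytic_self_map_def upper_half_plane_def)
  \<comment> \<open>The angle is an arbitrary choice: every such sector contains the positive
    imaginary axis, along which Julia's Lemma takes its limit.\<close>
  have "((\<lambda>z. \<phi> z / z) \<longlongrightarrow> 1) (at_infinity_in_sector (pi / 4))"
    by (rule assms(3)) auto
  then have "((\<lambda>t. \<phi> (\<i> * of_real t) / (\<i> * of_real t)) \<longlongrightarrow> 1) at_top"
    by (rule filterlim_compose) (simp add: filterlim_imaginary_axis_sector)
  then have mono: "Im z \<le> Im (\<phi> z)" if "Im z > 0" for z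
    using Julia_upper_half_plane[OF hol pos _ that] by blast
  interpret parabolic_displacement \<phi> "\<lambda>z. \<phi> z - z"
    by unfold_locales (auto simp: hol mono)
  obtain s L where s: "s > 0"
      "(\<lambda>n. pseudo_hyp_dist (orbit \<phi> n) (orbit \<phi> (Suc n))) \<longlonglongrightarrow> s"
    and L: "(\<lambda>n. Im (orbit \<phi> n)) \<longlonglongrightarrow> L"
    using assms(4) by (auto simp: type_Ia_def)
  \<comment> \<open>Heights of at least 1 and arguments tending to 0 send the orbit to infinity, and
    then its real parts to plus infinity.\<close>
  have re: "filterlim (\<lambda>n. Re (orbit \<phi> n)) at_top sequentially"
    using filterlim_Re_at_top[OF filterlim_at_infinity_of_Arg[OF Im_orbit_ge_1 _ assms(5)] assms(5)]
    by simp
  assume "\<exists>w. bounded_step_backward_seq \<phi> w \<and> filterlim w at_infinity sequentially \<and>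
            (\<lambda>n. Arg (w n)) \<longlonglongrightarrow> 0"
  then obtain w where "bounded_step_backward_seq \<phi> w"
      "filterlim w at_infinity sequentially" "(\<lambda>n. Arg (w n)) \<longlonglongrightarrow> 0"
    by blast
  then show False
    using no_backward_sequence_to_right[OF s L re] filterlim_Re_at_top by blast
qed

end
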